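(* Let $M$ be a non-degenerate Orlicz function. Then $M$ satisfies the $\Delta_2$ condition at zero if and only if $\sigma_M$ has a strong minimum at zero on $\ell_M$, or, in other words, the problem of minimizing $\sigma_M(x)$ over $x\in\ell_M$ is Tikhonov well-posed.
   Context: An Orlicz function is a continuous, non-decreasing, convex function $M:[0,\infty)\to[0,\infty)$ with $M(0)=0$ and $\lim_{t\to\infty}M(t)=\infty$. It is degenerate if $M(t)=0$ for some $t>0$, and non-degenerate otherwise. A non-degenerate $M$ satisfies the $\Delta_2$ condition at zero if $\liminf_{t\downarrow0}M(t)/M(2t)>0$. For a bounded real sequence $x$ put $\sigma_M(x)=\sum_{n=1}^\infty M(|x_n|)\in[0,\infty]$. The Orlicz sequence space $\ell_M$ is the linear space of all bounded real sequences $x$ with $\sigma_M(x/\rho)<\infty$ for some $\rho>0$, equipped with the norm $\|x\|=\inf\{\rho>0:\sigma_M(x/\rho)\le1\}$; it is a Banach space. A function $F:X\to\mathbb{R}\cup\{+\infty\}$ on a Banach space $X$ has a strong minimum at $\bar x$ (equivalently, the problem of minimizing $F$ over $X$ is Tikhonov well-posed with solution $\bar x$) if $F(\bar x)=\inf_X F\in\mathbb{R}$ and every sequence $(x_k)$ in $X$ with $F(x_k)\to\inf_XF$ converges in norm to $\bar x$. *)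

theory Defs
  imports "HOL-Analysis.Analysis" "HOL-Library.Function_Algebras"
begin

text \<open>Functions on \<open>[0,\<infinity>)\<close> are total functions on the reals, of which only the values at
  nonnegative arguments matter.  Sequences are indexed from \<open>0\<close> instead of \<open>1\<close>.\<close>

definition orlicz_function :: "(real \<Rightarrow> real) \<Rightarrow> bool" where
  "orlicz_function M \<longleftrightarrow>
     (\<forall>t\<ge>0. M t \<ge> 0) \<and> continuous_on {0..} M \<and> mono_on {0..} M \<and> convex_on {0..} M \<and>
     M 0 = 0 \<and> filterlim M at_top at_top"

definition degenerate :: "(real \<Rightarrow> real) \<Rightarrow> bool" where
  "degenerate M \<longleftrightarrow> (\<exists>t>0. M t = 0)"

text \<open>Only meaningful for non-degenerate \<open>M\<close>, where the denominator is nonzero.\<close>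

definition delta2_at_zero :: "(real \<Rightarrow> real) \<Rightarrow> bool" where
  "delta2_at_zero M \<longleftrightarrow> Liminf (at_right 0) (\<lambda>t. ereal (M t / M (2 * t))) > 0"

definition orlicz_sigma :: "(real \<Rightarrow> real) \<Rightarrow> (nat \<Rightarrow> real) \<Rightarrow> ereal" where
  "orlicz_sigma M x = (\<Sum>n. ereal (M \<bar>x n\<bar>))"

definition orlicz_space :: "(real \<Rightarrow> real) \<Rightarrow> (nat \<Rightarrow> real) set" where
  "orlicz_space M = {x. Bseq x \<and> (\<exists>\<rho>>0. orlicz_sigma M (\<lambda>n. x n / \<rho>) < \<infinity>)}"

definition orlicz_norm :: "(real \<Rightarrow> real) \<Rightarrow> (nat \<Rightarrow> real) \<Rightarrow> real" where
  "orlicz_norm M x = Inf {\<rho>. \<rho> > 0 \<and> orlicz_sigma M (\<lambda>n. x n / \<rho>) \<le> 1}"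

text \<open>The space \<open>\<ell>\<^sub>M\<close> depends on the variable \<open>M\<close>, so it is not a type; a normed space is therefore
  given by its underlying set \<open>X\<close> inside an ambient group and its norm \<open>N\<close>.\<close>

definition strong_minimum_at ::
  "'a::ab_group_add set \<Rightarrow> ('a \<Rightarrow> real) \<Rightarrow> ('a \<Rightarrow> ereal) \<Rightarrow> 'a \<Rightarrow> bool" where
  "strong_minimum_at X N F a \<longleftrightarrow>
     a \<in> X \<and> F a = (INF x\<in>X. F x) \<and> \<bar>INF x\<in>X. F x\<bar> \<noteq> \<infinity> \<and>
     (\<forall>u :: nat \<Rightarrow> 'a. (\<forall>k. u k \<in> X) \<longrightarrow> (\<lambda>k. F (u k)) \<longlonglongrightarrow> (INF x\<in>X. F x) \<longrightarrow>
        (\<lambda>k. N (u k - a)) \<longlonglongrightarrow> 0)"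

definition tikhonov_well_posed ::
  "'a::ab_group_add set \<Rightarrow> ('a \<Rightarrow> real) \<Rightarrow> ('a \<Rightarrow> ereal) \<Rightarrow> bool" where
  "tikhonov_well_posed X N F \<longleftrightarrow> (\<exists>a. strong_minimum_at X N F a)"

end

theory Submission
  imports Defs
begin

text \<open>
  Nonnegativity and non-degeneracy make \<open>0\<close> the only minimizer of \<open>\<sigma>\<^sub>M\<close>.
  If \<open>M (2 t) \<le> K M t\<close> near \<open>0\<close> and \<open>\<sigma>\<^sub>M x\<close> is small, then all coordinates of \<open>x\<close> are small, so
  the estimate can be iterated to \<open>\<sigma>\<^sub>M (2\<^sup>m x) \<le> K\<^sup>m \<sigma>\<^sub>M x \<le> 1\<close>, that is, \<open>\<parallel>x\<parallel> \<le> 2\<^sup>-\<^sup>m\<close>.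
  If instead \<open>M t / M (2 t)\<close> gets arbitrarily small near \<open>0\<close>, take a sequence with \<open>N\<close> entries \<open>t\<close>
  and all others \<open>0\<close>, where \<open>N M (2 t)\<close> is just above \<open>1\<close>: then \<open>\<sigma>\<^sub>M x = N M t\<close> is small while
  \<open>\<sigma>\<^sub>M (2 x) > 1\<close> forces \<open>\<parallel>x\<parallel> \<ge> 1/2\<close>.
\<close>

lemma Liminf_ereal_pos_iff:
  fixes f :: "'a \<Rightarrow> real"
  shows "0 < Liminf F (\<lambda>t. ereal (f t)) \<longleftrightarrow> (\<exists>c>0. \<forall>\<^sub>F t in F. c \<le> f t)"
proof
  assume "0 < Liminf F (\<lambda>t. ereal (f t))"
  then obtain c where "0 < ereal c" "ereal c < Liminf F (\<lambda>t. ereal (f t))"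
    using ereal_dense2 by blast
  then show "\<exists>c>0. \<forall>\<^sub>F t in F. c \<le> f t"
    by (auto intro!: exI[of _ c] dest!: less_LiminfD elim!: eventually_mono)
next
  assume "\<exists>c>0. \<forall>\<^sub>F t in F. c \<le> f t"
  then obtain c where "c > 0" "\<forall>\<^sub>F t in F. ereal c \<le> ereal (f t)"
    by auto
  then show "0 < Liminf F (\<lambda>t. ereal (f t))"
    using Liminf_bounded[of "ereal c" "\<lambda>t. ereal (f t)" F]
    by (meson ereal_less(2) less_le_trans)
qed

locale nondegenerate_orlicz =
  fixes M :: "real \<Rightarrow> real"
  assumes orlicz: "orlicz_function M" and nondeg: "\<not> degenerate M"
begin

section \<open>Elementary properties of \<open>M\<close> and \<open>orlicz_sigma\<close>\<close>

lemma M_nonneg: "0 \<le> t \<Longrightarrow> 0 \<le> M t"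
  using orlicz by (simp add: orlicz_function_def)

lemma M_zero: "M 0 = 0"
  using orlicz by (simp add: orlicz_function_def)

lemma M_mono: "0 \<le> s \<Longrightarrow> s \<le> t \<Longrightarrow> M s \<le> M t"
  using orlicz by (auto simp: orlicz_function_def mono_on_def)

lemma M_pos: "0 < t \<Longrightarrow> 0 < M t"
  using nondeg M_nonneg[of t] by (fastforce simp: degenerate_def)

lemma M_tendsto_zero: "(M \<longlongrightarrow> 0) (at_right 0)"
proof -
  have "(M \<longlongrightarrow> M 0) (at 0 within {0..})"
    using orlicz unfolding orlicz_function_def continuous_on_def by (meson atLeast_iff order_refl)
  then show ?thesis
    by (simp add: M_zero at_within_Ici_at_right)
qed

text \<open>Non-degeneracy gives \<open>M (2 * t) > 0\<close> for \<open>t > 0\<close>, so the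
  quotient can be cleared. Both directions of the theorem use this division-free form.\<close>

lemma delta2_iff: "delta2_at_zero M \<longleftrightarrow> (\<exists>c>0. \<forall>\<^sub>F t in at_right 0. c * M (2 * t) \<le> M t)"
proof -
  have "(\<forall>\<^sub>F t in at_right 0. c \<le> M t / M (2 * t)) \<longleftrightarrow>
        (\<forall>\<^sub>F t in at_right 0. c * M (2 * t) \<le> M t)" for c
    by (intro eventually_cong[OF eventually_at_right_less[of 0]])
      (simp add: pos_le_divide_eq M_pos)
  then show ?thesis
    by (simp add: delta2_at_zero_def Liminf_ereal_pos_iff)
qed

lemma sigma_zero: "orlicz_sigma M (\<lambda>n. 0) = 0"
  by (simp add: orlicz_sigma_def M_zero flip: zero_ereal_def)

lemma sigma_nonneg: "0 \<le> orlicz_sigma M x"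
  unfolding orlicz_sigma_def by (intro suminf_nonneg summable_ereal_pos) (auto simp: M_nonneg)

lemma sigma_ge_term: "ereal (M \<bar>x n\<bar>) \<le> orlicz_sigma M x"
  unfolding orlicz_sigma_def
  using sum_le_suminf[of "\<lambda>n. ereal (M \<bar>x n\<bar>)" "{n}"]
  by (auto simp: M_nonneg summable_ereal_pos)

lemma sigma_mono:
  assumes "\<And>n. \<bar>x n\<bar> \<le> \<bar>y n\<bar>"
  shows "orlicz_sigma M x \<le> orlicz_sigma M y"
  unfolding orlicz_sigma_def
  by (intro suminf_le summable_ereal_pos) (auto simp: M_nonneg M_mono assms)

lemma sigma_eq_0_iff: "orlicz_sigma M x = 0 \<longleftrightarrow> (\<forall>n. x n = 0)"
proof
  assume *: "orlicz_sigma M x = 0"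
  show "\<forall>n. x n = 0"
  proof
    fix n
    have "M \<bar>x n\<bar> \<le> 0"
      using sigma_ge_term[of x n] * by simp
    then show "x n = 0"
      using M_pos[of "\<bar>x n\<bar>"] by fastforce
  qed
next
  assume "\<forall>n. x n = 0"
  then show "orlicz_sigma M x = 0"
    by (simp add: orlicz_sigma_def M_zero flip: zero_ereal_def)
qed

lemma zero_in_space: "0 \<in> orlicz_space M"
  by (auto simp: orlicz_space_def sigma_zero zero_fun_def intro: exI[of _ 1])

lemma sigma_0: "orlicz_sigma M 0 = 0"
  by (simp add: sigma_eq_0_iff)

lemma INF_sigma: "(INF x\<in>orlicz_space M. orlicz_sigma M x) = 0"
  by (rule antisym) (use zero_in_space in \<open>auto intro: INF_lower2 INF_greatest simp: sigma_0 sigma_nonneg\<close>)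

section \<open>Norm bounds and reduction to a minimum at \<open>0\<close>\<close>

lemma norm_le:
  assumes "\<rho> > 0" "orlicz_sigma M (\<lambda>n. x n / \<rho>) \<le> 1"
  shows "orlicz_norm M x \<le> \<rho>"
  unfolding orlicz_norm_def using assms by (intro cInf_lower bdd_belowI[of _ 0]) auto

text \<open>The premises exhibit an admissible \<open>\<rho>\<close>: an infimum over the empty set
  of reals would carry no information.\<close>

lemma norm_nonneg:
  assumes "\<rho> > 0" "orlicz_sigma M (\<lambda>n. x n / \<rho>) \<le> 1"
  shows "0 \<le> orlicz_norm M x"
  unfolding orlicz_norm_def using assms by (intro cInf_greatest) auto

text \<open>An admissible \<open>\<rho> < r\<close> would give a larger sigma at scale
  \<open>\<rho>\<close> than at \<open>r\<close>, hence a value above 1. The first premise makes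
  \<open>\<rho> = 1\<close> admissible, so the infimum is over a nonempty set.\<close>

lemma norm_ge:
  assumes "orlicz_sigma M x \<le> 1" "r > 0" "1 < orlicz_sigma M (\<lambda>n. x n / r)"
  shows "r \<le> orlicz_norm M x"
  unfolding orlicz_norm_def
proof (intro cInf_greatest)
  show "{\<rho>. \<rho> > 0 \<and> orlicz_sigma M (\<lambda>n. x n / \<rho>) \<le> 1} \<noteq> {}"
    using assms(1) by (auto intro: exI[of _ 1])
next
  fix \<rho> assume \<rho>: "\<rho> \<in> {\<rho>. \<rho> > 0 \<and> orlicz_sigma M (\<lambda>n. x n / \<rho>) \<le> 1}"
  show "r \<le> \<rho>"
  proof (rule ccontr)
    assume "\<not> r \<le> \<rho>"
    with \<rho> have "orlicz_sigma M (\<lambda>n. x n / r) \<le> orlicz_sigma M (\<lambda>n. x n / \<rho>)"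
      by (intro sigma_mono) (auto simp: abs_divide intro!: divide_left_mono)
    with \<rho> assms(3) show False
      by (auto dest: less_le_trans)
  qed
qed

lemma strong_minimum_0_iff:
  "strong_minimum_at (orlicz_space M) (orlicz_norm M) (orlicz_sigma M) 0 \<longleftrightarrow>
     (\<forall>u. (\<forall>k. u k \<in> orlicz_space M) \<longrightarrow> (\<lambda>k. orlicz_sigma M (u k)) \<longlonglongrightarrow> 0 \<longrightarrow>
        (\<lambda>k. orlicz_norm M (u k)) \<longlonglongrightarrow> 0)"
  by (simp add: strong_minimum_at_def zero_in_space sigma_0 INF_sigma)

text \<open>The infimum is 0 and only the zero sequence attains it. Thus well-posedness can have no
  solution other than \<open>0\<close>.\<close>

lemma strong_minimum_imp_eq_0:
  assumes "strong_minimum_at (orlicz_space M) N (orlicz_sigma M) a"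
  shows "a = 0"
  using assms by (auto simp: strong_minimum_at_def INF_sigma sigma_eq_0_iff)

lemma tikhonov_iff:
  "tikhonov_well_posed (orlicz_space M) N (orlicz_sigma M) \<longleftrightarrow>
     strong_minimum_at (orlicz_space M) N (orlicz_sigma M) 0"
  using strong_minimum_imp_eq_0 by (auto simp: tikhonov_well_posed_def)

section \<open>The doubling condition forces convergence in norm\<close>

text \<open>The bound on \<open>t\<close> keeps every intermediate argument \<open>2 ^ i * t\<close>
  with \<open>i < m\<close> below \<open>\<delta>\<close>, so \<open>dbl\<close> applies at each of
  the \<open>m\<close> doublings.\<close>

lemma M_doubling_power:
  assumes "c > 0" and dbl: "\<And>t. 0 < t \<Longrightarrow> t < \<delta> \<Longrightarrow> c * M (2 * t) \<le> M t"
    and "0 \<le> t" "t < \<delta> / 2 ^ m"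
  shows "M (2 ^ m * t) \<le> M t / c ^ m"
  using assms(4)
proof (induction m)
  case 0
  then show ?case by simp
next
  case (Suc m)
  have "0 \<le> 2 ^ m * t" "2 * (2 ^ m * t) < \<delta>"
    using Suc.prems \<open>0 \<le> t\<close> by (simp_all add: field_simps)
  then have lt: "2 ^ m * t < \<delta>"
    by linarith
  then have "t < \<delta> / 2 ^ m"
    by (simp add: field_simps)
  have "M (2 ^ Suc m * t) \<le> M (2 ^ m * t) / c"
  \<comment> \<open>\<open>dbl\<close> speaks of positive arguments only; at 0 both sides
    vanish.\<close>
  proof (cases "t = 0")
    case False
    with dbl[of "2 ^ m * t"] lt \<open>0 \<le> t\<close> \<open>c > 0\<close> show ?thesis
      by (simp add: field_simps)
  qed (simp add: M_zero)
  also have "\<dots> \<le> M t / c ^ m / c"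
    using Suc.IH \<open>t < \<delta> / 2 ^ m\<close> \<open>c > 0\<close> by (intro divide_right_mono) auto
  finally show ?case
    by (simp add: mult.commute)
qed

text \<open>Each term is at most the whole sum, so by monotonicity of \<open>M\<close> a small sum
  makes every coordinate small enough for the pointwise estimate, which is then summed. Scaling by
  \<open>2 ^ m\<close> is written as division to match \<open>norm_le\<close>.\<close>

lemma sigma_doubling_power:
  assumes "c > 0" and dbl: "\<And>t. 0 < t \<Longrightarrow> t < \<delta> \<Longrightarrow> c * M (2 * t) \<le> M t" and "\<delta> > 0"
    and small: "orlicz_sigma M x < ereal (M (\<delta> / 2 ^ m))"
  shows "orlicz_sigma M (\<lambda>n. x n / (1 / 2 ^ m)) \<le> ereal (1 / c ^ m) * orlicz_sigma M x"
proof -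
  have lt: "\<bar>x n\<bar> < \<delta> / 2 ^ m" for n
  proof (rule ccontr)
    assume "\<not> ?thesis"
    then have "M (\<delta> / 2 ^ m) \<le> M \<bar>x n\<bar>"
      using \<open>\<delta> > 0\<close> by (intro M_mono) auto
    then have "ereal (M (\<delta> / 2 ^ m)) \<le> orlicz_sigma M x"
      using sigma_ge_term[of x n] by (meson ereal_less_eq(3) order_trans)
    with small show False by simp
  qed
  have "orlicz_sigma M (\<lambda>n. x n / (1 / 2 ^ m)) \<le> (\<Sum>n. ereal (1 / c ^ m) * ereal (M \<bar>x n\<bar>))"
    unfolding orlicz_sigma_def
  proof (intro suminf_le summable_ereal_pos)
    fix n
    show "ereal (M \<bar>x n / (1 / 2 ^ m)\<bar>) \<le> ereal (1 / c ^ m) * ereal (M \<bar>x n\<bar>)"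
      using M_doubling_power[OF \<open>c > 0\<close> dbl _ lt[of n]] by (simp add: abs_mult mult.commute)
  qed (use \<open>c > 0\<close> in \<open>auto simp: M_nonneg\<close>)
  also have "\<dots> = ereal (1 / c ^ m) * orlicz_sigma M x"
    unfolding orlicz_sigma_def using \<open>c > 0\<close> by (intro suminf_cmult_ereal) (auto simp: M_nonneg)
  finally show ?thesis .
qed

lemma delta2_imp_norm_tendsto_zero:
  assumes "delta2_at_zero M" and lim: "(\<lambda>k. orlicz_sigma M (u k)) \<longlonglongrightarrow> 0"
  shows "(\<lambda>k. orlicz_norm M (u k)) \<longlonglongrightarrow> 0"
proof (rule LIMSEQ_I)
  fix e :: real assume "e > 0"
  obtain c \<delta> where c: "c > 0" "\<delta> > 0" "\<And>t. 0 < t \<Longrightarrow> t < \<delta> \<Longrightarrow> c * M (2 * t) \<le> M t"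
    using assms(1) by (auto simp: delta2_iff eventually_at_right_field)
  obtain m where m: "(1 / 2) ^ m < e"
    using \<open>e > 0\<close> real_arch_pow_inv[of e "1 / 2"] by auto
  \<comment> \<open>The first bound makes \<open>sigma_doubling_power\<close> applicable, the second
    makes its right-hand side at most 1.\<close>
  have "\<forall>\<^sub>F k in sequentially. orlicz_sigma M (u k) < ereal (min (M (\<delta> / 2 ^ m)) (c ^ m))"
    using c M_pos[of "\<delta> / 2 ^ m"] by (intro order_tendstoD[OF lim]) simp
  then have "\<forall>\<^sub>F k in sequentially. norm (orlicz_norm M (u k) - 0) < e"
  proof eventually_elim
    case (elim k)
    then have lt: "orlicz_sigma M (u k) < ereal (M (\<delta> / 2 ^ m))" "orlicz_sigma M (u k) < ereal (c ^ m)"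
      by (auto elim: less_le_trans)
    have "orlicz_sigma M (\<lambda>n. u k n / (1 / 2 ^ m)) \<le> ereal (1 / c ^ m) * orlicz_sigma M (u k)"
      using c lt by (intro sigma_doubling_power) auto
    also have "\<dots> \<le> ereal (1 / c ^ m) * ereal (c ^ m)"
      using lt c by (intro ereal_mult_left_mono) auto
    also have "\<dots> = 1"
      using c by simp
    finally have *: "orlicz_sigma M (\<lambda>n. u k n / (1 / 2 ^ m)) \<le> 1" .
    have "orlicz_norm M (u k) \<le> 1 / 2 ^ m" "0 \<le> orlicz_norm M (u k)"
      using norm_le[OF _ *] norm_nonneg[OF _ *] by simp_all
    with m show ?case
      by (simp add: power_one_over)
  qed
  then show "\<exists>k0. \<forall>k\<ge>k0. norm (orlicz_norm M (u k) - 0) < e"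
    by (simp add: eventually_sequentially)
qed

section \<open>Block sequences when the doubling condition fails\<close>

lemma sigma_block:
  "orlicz_sigma M (\<lambda>n. (if n < N then t else 0) / r) = ereal (real N * M \<bar>t / r\<bar>)"
proof -
  have "orlicz_sigma M (\<lambda>n. (if n < N then t else 0) / r) =
        (\<Sum>n<N. ereal (M \<bar>(if n < N then t else 0) / r\<bar>))"
    unfolding orlicz_sigma_def by (intro suminf_finite) (auto simp: M_zero zero_ereal_def)
  also have "\<dots> = (\<Sum>n<N. ereal (M \<bar>t / r\<bar>))"
    by (intro sum.cong) auto
  finally show ?thesis
    by (simp add: sum_ereal)
qed

lemma not_delta2_small_sigma_large_norm:
  assumes "\<not> delta2_at_zero M" and e: "0 < e" "e \<le> 1"
  obtains x where "x \<in> orlicz_space M" "orlicz_sigma M x \<le> ereal e" "1 / 2 \<le> orlicz_norm M x"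
proof -
  have "filterlim (\<lambda>t. 2 * t) (at_right 0) (at_right (0::real))"
    by (rule filterlim_times_pos[where l = 0]) (auto intro: filterlim_ident)
  then have "((\<lambda>t. M (2 * t)) \<longlongrightarrow> 0) (at_right 0)"
    by (rule filterlim_compose[OF M_tendsto_zero])
  then have le1: "\<forall>\<^sub>F t in at_right 0. M (2 * t) < 1"
    by (rule order_tendstoD) simp
  \<comment> \<open>The failing constant is taken as \<open>e / 2\<close> because \<open>N\<close>
    copies of \<open>M (2 * t)\<close> will add up to at most 2.\<close>
  have "\<exists>\<^sub>F t in at_right 0. \<not> e / 2 * M (2 * t) \<le> M t"
    using assms unfolding delta2_iff not_ex not_eventually[symmetric] by (metis half_gt_zero)
  then have "\<exists>\<^sub>F t in at_right 0. M t < e / 2 * M (2 * t) \<and> M (2 * t) < 1 \<and> 0 < t"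
    by (rule frequently_rev_mp)
      (use le1 eventually_at_right_less[of 0] in eventually_elim, simp add: not_le)
  then obtain t where t: "M t < e / 2 * M (2 * t)" "M (2 * t) < 1" "0 < t"
    by (auto dest: frequently_ex)
  define a where "a = M (2 * t)"
  have a: "0 < a" "a < 1"
    using t M_pos[of "2 * t"] by (auto simp: a_def)
  \<comment> \<open>The successor of the floor exceeds \<open>1 / a\<close> strictly, as
    \<open>norm_ge\<close> requires; overshooting by at most 1 gives
    \<open>N * a \<le> 1 + a\<close>, where \<open>a < 1\<close>.\<close>
  define N where "N = Suc (nat \<lfloor>1 / a\<rfloor>)"
  have "1 / a < real N" "real N \<le> 1 / a + 1"
    using a by (auto simp: N_def) linarith+
  then have N: "1 < real N * a" "real N * a \<le> 2"
    using a by (auto simp: field_simps)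
  define x where "x = (\<lambda>n. if n < N then t else 0)"
  have sx: "orlicz_sigma M (\<lambda>n. x n / r) = ereal (real N * M \<bar>t / r\<bar>)" for r
    unfolding x_def by (rule sigma_block)
  have "real N * M t \<le> real N * (e / 2 * a)"
    using t by (intro mult_left_mono) (auto simp: a_def)
  also have "\<dots> \<le> e"
    using N e mult_left_mono[of "real N * a" 2 "e / 2"] by (simp add: mult_ac)
  finally have small: "orlicz_sigma M x \<le> ereal e"
    using sx[of 1] t by simp
  have "Bseq x"
    using t by (intro BseqI'[of _ t]) (auto simp: x_def)
  then have "x \<in> orlicz_space M"
    using sx[of 1] by (auto simp: orlicz_space_def intro!: exI[of _ 1])
  moreover have "1 / 2 \<le> orlicz_norm M x"
  proof (rule norm_ge)
    show "orlicz_sigma M x \<le> 1"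
      using small e by (metis ereal_less_eq(3) one_ereal_def order_trans)
    show "1 < orlicz_sigma M (\<lambda>n. x n / (1 / 2))"
      using sx[of "1 / 2"] N t by (simp add: a_def mult.commute)
  qed simp
  ultimately show ?thesis
    using small that by blast
qed

lemma delta2_iff_strong_minimum:
  "delta2_at_zero M \<longleftrightarrow>
     strong_minimum_at (orlicz_space M) (orlicz_norm M) (orlicz_sigma M) 0"
proof
  assume "delta2_at_zero M"
  then show "strong_minimum_at (orlicz_space M) (orlicz_norm M) (orlicz_sigma M) 0"
    by (simp add: strong_minimum_0_iff delta2_imp_norm_tendsto_zero)
next
  assume min: "strong_minimum_at (orlicz_space M) (orlicz_norm M) (orlicz_sigma M) 0"
  show "delta2_at_zero M"
  proof (rule ccontr)
    assume nd: "\<not> delta2_at_zero M"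
    \<comment> \<open>These sequences form a minimizing sequence whose norms stay away from
      0.\<close>
    have "\<exists>x. x \<in> orlicz_space M \<and> orlicz_sigma M x \<le> ereal (1 / real (Suc k)) \<and>
        1 / 2 \<le> orlicz_norm M x" for k
      by (rule not_delta2_small_sigma_large_norm[OF nd, of "1 / real (Suc k)"]) auto
    then obtain u where u: "\<And>k. u k \<in> orlicz_space M"
      "\<And>k. orlicz_sigma M (u k) \<le> ereal (1 / real (Suc k))" "\<And>k. 1 / 2 \<le> orlicz_norm M (u k)"
      by metis
    have "(\<lambda>k. ereal (1 / real (Suc k))) \<longlonglongrightarrow> 0"
      using LIMSEQ_inverse_real_of_nat by (simp add: zero_ereal_def inverse_eq_divide)
    then have "(\<lambda>k. orlicz_sigma M (u k)) \<longlonglongrightarrow> 0"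
      by (rule tendsto_sandwich[OF _ _ tendsto_const, rotated 2])
        (auto simp: sigma_nonneg u(2) simp del: of_nat_Suc)
    with min u(1) have "(\<lambda>k. orlicz_norm M (u k)) \<longlonglongrightarrow> 0"
      by (simp add: strong_minimum_0_iff)
    then have "(1 / 2 :: real) \<le> 0"
      by (rule LIMSEQ_le_const) (use u(3) in blast)
    then show False by simp
  qed
qed

end

theorem lemma3p1:
  fixes M :: "real \<Rightarrow> real"
  assumes "orlicz_function M" and "\<not> degenerate M"
  shows "(delta2_at_zero M \<longleftrightarrow>
            strong_minimum_at (orlicz_space M) (orlicz_norm M) (orlicz_sigma M) 0) \<and>
         (delta2_at_zero M \<longleftrightarrow>
            tikhonov_well_posed (orlicz_space M) (orlicz_norm M) (orlicz_sigma M))"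
proof -
  interpret nondegenerate_orlicz M
    using assms by unfold_locales
  show ?thesis
    using delta2_iff_strong_minimum tikhonov_iff by simp
qed

end
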